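(* Let $M\in\mathbb{R}^{n\times n}$ with $\|M\|_F^2=1$ and singular value decomposition $M=U\Sigma V^\top$, where $\Sigma=\operatorname{diag}(\sigma_1,\dots,\sigma_n)$ with $0\le\sigma_k\le1$. Let $a,b,c\in\mathbb{R}$ and $$Q:=aM+b(MM^\top)M+c(MM^\top)^2M .$$ Assume that $U$ is Haar distributed on the orthogonal group. Let $$\lambda_k:=\sigma_k^2,\qquad g(\lambda):=\varphi(\sqrt{\lambda})^2=\lambda(a+b\lambda+c\lambda^2)^2,\qquad\text{where }\varphi(x):=ax+bx^3+cx^5 .$$ Then, for each pair $1\le i<j\le n$, there exists $$\xi_{ij}\in\bigl(\min\{\lambda_i,\lambda_j\},\,\max\{\lambda_i,\lambda_j\}\bigr)$$ such that $$\mathbb{E}\bigl[\operatorname{Var}(s(Q))-\operatorname{Var}(s(M))\bigr]=\frac{2}{n^2(n+2)}\sum_{1\le i<j\le n}(\lambda_i-\lambda_j)^2\bigl(g'(\xi_{ij})^2-1\bigr).$$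
   Context: For $X\in\mathbb{R}^{n\times n}$ with rows $X_{1:},\dots,X_{n:}$, define $s(X):=(\|X_{1:}\|_2^2,\dots,\|X_{n:}\|_2^2)$, the vector of squared Euclidean row norms, and $$\operatorname{Var}(s(X)):=\frac1n\sum_{i=1}^n\Bigl(\|X_{i:}\|_2^2-\frac1n\|X\|_F^2\Bigr)^2 .$$ Here $\|\cdot\|_F$ is the Frobenius norm, the orthogonal group is the group of all real $n\times n$ matrices $U$ with $U^\top U=I$, the singular values $\sigma_k$ are fixed, and the expectation is over the Haar-distributed $U$. The matrix $Q$ is the result of one Newton–Schulz (polar) step applied to $M$, and $Q=U\varphi(\Sigma)V^\top$ with $\varphi$ applied to the diagonal entries.
   Formalization: The membership of ξ_ij in the open interval is claimed only for pairs with λ_i ≠ λ_j, since for λ_i = λ_j the interval is empty; such pairs contribute 0 to the sum, and the identity is still stated for all admissible σ. *)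

theory Defs
  imports "HOL-Probability.Probability"
begin

definition diag_mat :: "real ^ 'n \<Rightarrow> real ^ 'n ^ 'n" where
  "diag_mat d = (\<chi> i j. if i = j then d $ i else 0)"

definition row_sqnorms :: "real ^ 'n ^ 'n \<Rightarrow> real ^ 'n" where
  "row_sqnorms X = (\<chi> i. (norm (row i X))\<^sup>2)"

(* The library norm on real ^ 'n ^ 'n is the l2 norm of the row norms, hence
   norm X is the Frobenius norm of X. *)
definition row_sqnorm_var :: "real ^ 'n ^ 'n \<Rightarrow> real" where
  "row_sqnorm_var X =
     (1 / real CARD('n)) *
     (\<Sum>i\<in>UNIV. (row_sqnorms X $ i - (1 / real CARD('n)) * (norm X)\<^sup>2)\<^sup>2)"

definition newton_schulz :: "real \<Rightarrow> real \<Rightarrow> real \<Rightarrow> real ^ 'n ^ 'n \<Rightarrow> real ^ 'n ^ 'n" where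
  "newton_schulz a b c M =
     a *\<^sub>R M + b *\<^sub>R ((M ** transpose M) ** M)
     + c *\<^sub>R (((M ** transpose M) ** (M ** transpose M)) ** M)"

definition ns_phi :: "real \<Rightarrow> real \<Rightarrow> real \<Rightarrow> real \<Rightarrow> real" where
  "ns_phi a b c x = a * x + b * x ^ 3 + c * x ^ 5"

definition ns_g :: "real \<Rightarrow> real \<Rightarrow> real \<Rightarrow> real \<Rightarrow> real" where
  "ns_g a b c l = (ns_phi a b c (sqrt l))\<^sup>2"

lemma ns_g_eq:
  assumes "0 \<le> l"
  shows "ns_g a b c l = l * (a + b * l + c * l\<^sup>2)\<^sup>2"
proof -
  have "ns_phi a b c (sqrt l) = sqrt l * (a + b * (sqrt l)\<^sup>2 + c * ((sqrt l)\<^sup>2)\<^sup>2)"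
    unfolding ns_phi_def by algebra
  then show ?thesis
    using assms by (simp add: ns_g_def power_mult_distrib)
qed

abbreviation orthogonal_space :: "(real ^ 'n ^ 'n) measure" where
  "orthogonal_space \<equiv> restrict_space borel {U. orthogonal_matrix U}"

(* Normalized Haar measure on the orthogonal group: the left-invariant Borel
   probability measure. Regularity is automatic for a finite Borel measure on a
   compact metric space, and right invariance follows since the group is compact. *)
definition haar_orthogonal :: "(real ^ 'n ^ 'n) measure \<Rightarrow> bool" where
  "haar_orthogonal \<nu> \<longleftrightarrow>
     prob_space \<nu> \<and> sets \<nu> = sets orthogonal_space \<and>
     (\<forall>A. orthogonal_matrix A \<longrightarrow> distr \<nu> \<nu> (\<lambda>U. A ** U) = \<nu>)"

definition haar_distributed :: "'w measure \<Rightarrow> ('w \<Rightarrow> real ^ 'n ^ 'n) \<Rightarrow> bool" where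
  "haar_distributed P U \<longleftrightarrow>
     U \<in> measurable P orthogonal_space \<and> haar_orthogonal (distr P orthogonal_space U)"

end

theory Submission imports Defs begin

text \<open>
  The squared row norms of \<open>U diag(d) V\<^sup>T\<close> are the diagonal entries of
  \<open>B = U diag(d\<^sup>2) U\<^sup>T\<close>, so only \<open>E \<Sum>\<^sub>i B\<^sub>i\<^sub>i\<^sup>2\<close> has to be computed. The reflection that sends
  rows \<open>i \<noteq> j\<close> of \<open>U\<close> to their normalized sum and difference preserves Haar measure, which gives
  \<open>E (B\<^sub>i\<^sub>i\<^sup>2 + B\<^sub>j\<^sub>j\<^sup>2) = E (2 B\<^sub>i\<^sub>i B\<^sub>j\<^sub>j + 4 B\<^sub>i\<^sub>j\<^sup>2)\<close>. Summed over all pairs, the right-hand side is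
  determined by \<open>tr B\<close> and the Frobenius norm of \<open>B\<close>, which do not depend on \<open>U\<close>; hence
  \<open>(n + 2) E \<Sum>\<^sub>i B\<^sub>i\<^sub>i\<^sup>2 = (tr B)\<^sup>2 + 2 tr (B\<^sup>2)\<close>. The expected variance is therefore a multiple of
  the sum of the squared differences of the numbers \<open>d\<^sub>k\<^sup>2\<close>, and the mean value theorem for \<open>g\<close>
  turns the differences after the step into differences before it.
\<close>

section \<open>Entries \<open>row_form d X i j\<close> of the matrix
  \<open>X ** diag_mat d ** transpose X\<close>, their trace and their sum of squares\<close>

definition row_form :: "real ^ 'n \<Rightarrow> real ^ 'n ^ 'm \<Rightarrow> 'm \<Rightarrow> 'm \<Rightarrow> real" where
  "row_form d X i j = (\<Sum>k\<in>UNIV. d $ k * X $ i $ k * X $ j $ k)"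

lemma orthogonal_matrix_rows:
  fixes U :: "real ^ 'n ^ 'n"
  assumes "orthogonal_matrix U"
  shows "(\<Sum>k\<in>UNIV. U $ i $ k * U $ j $ k) = (if i = j then 1 else 0)"
proof -
  have "(U ** transpose U) $ i $ j = (mat 1 :: real ^ 'n ^ 'n) $ i $ j"
    using assms by (simp add: orthogonal_matrix_def)
  then show ?thesis
    by (simp add: matrix_matrix_mult_def transpose_def mat_def)
qed

lemma orthogonal_matrix_columns:
  fixes U :: "real ^ 'n ^ 'n"
  assumes "orthogonal_matrix U"
  shows "(\<Sum>i\<in>UNIV. U $ i $ k * U $ i $ l) = (if k = l then 1 else 0)"
proof -
  have "(transpose U ** U) $ k $ l = (mat 1 :: real ^ 'n ^ 'n) $ k $ l"
    using assms by (simp add: orthogonal_matrix_def)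
  then show ?thesis
    by (simp add: matrix_matrix_mult_def transpose_def mat_def)
qed

lemma row_form_trace:
  fixes U :: "real ^ 'n ^ 'n"
  assumes "orthogonal_matrix U"
  shows "(\<Sum>i\<in>UNIV. row_form d U i i) = (\<Sum>k\<in>UNIV. d $ k)"
proof -
  have "(\<Sum>i\<in>UNIV. row_form d U i i) = (\<Sum>k\<in>UNIV. d $ k * (\<Sum>i\<in>UNIV. U $ i $ k * U $ i $ k))"
    unfolding row_form_def sum_distrib_left by (subst sum.swap) (simp add: mult.assoc)
  then show ?thesis
    by (simp add: orthogonal_matrix_columns[OF assms])
qed

text \<open>With B = U diag(d) U^T, orthogonality gives B B^T = U diag(d^2) U^T. Row i of B
  therefore has squared norm (B B^T)_ii, and summing over i gives the trace of diag(d^2).\<close>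

lemma row_form_sum_squares:
  fixes U :: "real ^ 'n ^ 'n"
  assumes "orthogonal_matrix U"
  shows "(\<Sum>i\<in>UNIV. \<Sum>j\<in>UNIV. (row_form d U i j)\<^sup>2) = (\<Sum>k\<in>UNIV. (d $ k)\<^sup>2)"
proof -
  have "(\<Sum>j\<in>UNIV. (row_form d U i j)\<^sup>2) = (\<Sum>k\<in>UNIV. (d $ k)\<^sup>2 * (U $ i $ k * U $ i $ k))" for i
  proof -
    have "(\<Sum>j\<in>UNIV. (row_form d U i j)\<^sup>2) =
      (\<Sum>j\<in>UNIV. \<Sum>k\<in>UNIV. \<Sum>l\<in>UNIV. (d $ k * U $ i $ k * (d $ l * U $ i $ l)) * (U $ j $ k * U $ j $ l))"
      unfolding row_form_def power2_eq_square sum_product by (simp add: mult_ac)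
    also have "\<dots> = (\<Sum>k\<in>UNIV. \<Sum>j\<in>UNIV. \<Sum>l\<in>UNIV. (d $ k * U $ i $ k * (d $ l * U $ i $ l)) * (U $ j $ k * U $ j $ l))"
      by (rule sum.swap)
    \<comment> \<open>With j innermost, the inner sum is the scalar product of columns k and l of
      \<open>U\<close>, which collapses the double sum to k = l.\<close>
    also have "\<dots> = (\<Sum>k\<in>UNIV. \<Sum>l\<in>UNIV. \<Sum>j\<in>UNIV. (d $ k * U $ i $ k * (d $ l * U $ i $ l)) * (U $ j $ k * U $ j $ l))"
      by (intro sum.cong refl sum.swap)
    also have "\<dots> = (\<Sum>k\<in>UNIV. \<Sum>l\<in>UNIV. if k = l then d $ k * U $ i $ k * (d $ l * U $ i $ l) else 0)"
      by (intro sum.cong refl) (simp add: sum_distrib_left[symmetric] orthogonal_matrix_columns[OF assms])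
    also have "\<dots> = (\<Sum>k\<in>UNIV. (d $ k)\<^sup>2 * (U $ i $ k * U $ i $ k))"
      by (simp add: power2_eq_square mult_ac)
    finally show ?thesis .
  qed
  then have "(\<Sum>i\<in>UNIV. \<Sum>j\<in>UNIV. (row_form d U i j)\<^sup>2) =
      (\<Sum>i\<in>UNIV. \<Sum>k\<in>UNIV. (d $ k)\<^sup>2 * (U $ i $ k * U $ i $ k))"
    by simp
  also have "\<dots> = (\<Sum>k\<in>UNIV. (d $ k)\<^sup>2 * (\<Sum>i\<in>UNIV. U $ i $ k * U $ i $ k))"
    unfolding sum_distrib_left by (rule sum.swap)
  finally show ?thesis
    by (simp add: orthogonal_matrix_columns[OF assms])
qed

section \<open>The reflection mixing two rows\<close>

definition mix_matrix :: "'n \<Rightarrow> 'n \<Rightarrow> real ^ 'n ^ 'n" where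
  "mix_matrix i j = (\<chi> p q.
     if p = i then (if q = i \<or> q = j then 1 / sqrt 2 else 0)
     else if p = j then (if q = i then 1 / sqrt 2 else if q = j then - 1 / sqrt 2 else 0)
     else if p = q then 1 else 0)"

lemma mix_matrix_mult:
  fixes X :: "real ^ 'm ^ 'n"
  assumes "i \<noteq> j"
  shows "(mix_matrix i j ** X) $ p $ k =
    (if p = i then (X $ i $ k + X $ j $ k) / sqrt 2
     else if p = j then (X $ i $ k - X $ j $ k) / sqrt 2 else X $ p $ k)"
proof -
  have *: "(mix_matrix i j ** X) $ p $ k = (\<Sum>q\<in>UNIV. mix_matrix i j $ p $ q * X $ q $ k)"
    by (simp add: matrix_matrix_mult_def)
  consider "p = i" | "p = j" "p \<noteq> i" | "p \<noteq> i" "p \<noteq> j" by blast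
  then show ?thesis
  proof cases
    case 1
    have "mix_matrix i j $ i $ q * X $ q $ k =
      (if q = i then X $ i $ k / sqrt 2 else 0) + (if q = j then X $ j $ k / sqrt 2 else 0)" for q
      using assms by (simp add: mix_matrix_def)
    then show ?thesis unfolding * using 1 by (simp add: sum.distrib add_divide_distrib)
  next
    case 2
    have "mix_matrix i j $ j $ q * X $ q $ k =
      (if q = i then X $ i $ k / sqrt 2 else 0) - (if q = j then X $ j $ k / sqrt 2 else 0)" for q
      using assms by (simp add: mix_matrix_def)
    then show ?thesis unfolding * using 2 by (simp add: sum_subtractf diff_divide_distrib)
  next
    case 3
    have "mix_matrix i j $ p $ q * X $ q $ k = (if q = p then X $ p $ k else 0)" for q
      using 3 by (simp add: mix_matrix_def)
    then show ?thesis unfolding * using 3 by simp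
  qed
qed

text \<open>The matrix is symmetric and squares to the identity. Distinct indices matter: for i = j
  the diagonal entry 1 / sqrt 2 would be alone in its row.\<close>

lemma orthogonal_mix_matrix:
  assumes "i \<noteq> j"
  shows "orthogonal_matrix (mix_matrix i j)"
proof -
  have "transpose (mix_matrix i j) = mix_matrix i j"
    using assms by (auto simp: mix_matrix_def transpose_def vec_eq_iff)
  moreover have "mix_matrix i j ** mix_matrix i j = mat 1"
    unfolding vec_eq_iff mix_matrix_mult[OF assms]
    using assms by (auto simp: mix_matrix_def mat_def field_simps)
  ultimately show ?thesis
    by (simp add: orthogonal_matrix)
qed

text \<open>With m = (B_ii + B_jj) / 2, the mixed rows have diagonal entries m + B_ij and m - B_ij.
  The cross terms cancel when their squares are added, which leaves 2 m^2 + 2 B_ij^2.\<close>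

lemma row_form_mix_matrix:
  assumes "i \<noteq> j"
  shows "(row_form d (mix_matrix i j ** X) i i)\<^sup>2 + (row_form d (mix_matrix i j ** X) j j)\<^sup>2 =
    (row_form d X i i + row_form d X j j)\<^sup>2 / 2 + 2 * (row_form d X i j)\<^sup>2"
proof -
  have "row_form d (mix_matrix i j ** X) i i = (row_form d X i i + row_form d X j j) / 2 + row_form d X i j"
    unfolding row_form_def mix_matrix_mult[OF assms]
    by (simp add: sum.distrib[symmetric] sum_divide_distrib field_simps)
  moreover have "row_form d (mix_matrix i j ** X) j j = (row_form d X i i + row_form d X j j) / 2 - row_form d X i j"
    unfolding row_form_def mix_matrix_mult[OF assms] using assms
    by (simp add: sum.distrib[symmetric] sum_subtractf[symmetric] sum_divide_distrib field_simps)
  ultimately show ?thesis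
    by (simp only:) (simp add: power2_eq_square field_simps)
qed

section \<open>Continuous functions under Haar measure\<close>

lemma borel_measurable_orthogonal_space:
  fixes f :: "real ^ 'n ^ 'n \<Rightarrow> 'b :: topological_space"
  assumes "continuous_on UNIV f"
  shows "f \<in> borel_measurable orthogonal_space"
  by (intro measurable_restrict_space1 borel_measurable_continuous_onI assms)

lemma continuous_on_row_form [continuous_intros]:
  fixes d :: "real ^ 'n"
  shows "continuous_on S (\<lambda>X. row_form d X i j)"
  unfolding row_form_def by (intro continuous_intros)

lemma compact_orthogonal: "compact {U :: real ^ 'n ^ 'n. orthogonal_matrix U}"
proof -
  have "closed {U :: real ^ 'n ^ 'n. transpose U ** U = mat 1}"
    by (intro closed_Collect_eq continuous_intros)
       (auto simp: transpose_def matrix_matrix_mult_def intro!: continuous_intros)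
  moreover have "norm U \<le> real CARD('n)" if "orthogonal_matrix U" for U :: "real ^ 'n ^ 'n"
  proof -
    have "norm U \<le> (\<Sum>i\<in>UNIV. norm (U $ i))"
      by (simp add: norm_vec_def L2_set_le_sum)
    also have "\<dots> = real CARD('n)"
      using orthogonal_matrix_rows[OF that]
      by (simp add: norm_vec_def L2_set_def power2_eq_square)
    finally show ?thesis .
  qed
  ultimately show ?thesis
    unfolding compact_eq_bounded_closed orthogonal_matrix bounded_iff by auto
qed

text \<open>The measure is finite and lives on the compact orthogonal group, where a continuous
  function is bounded. This covers every polynomial in the matrix entries integrated below.\<close>

lemma integrable_haar_orthogonal:
  fixes f :: "real ^ 'n ^ 'n \<Rightarrow> real"
  assumes "haar_orthogonal \<nu>" and "continuous_on UNIV f"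
  shows "integrable \<nu> f"
proof -
  interpret prob_space \<nu> using assms(1) by (simp add: haar_orthogonal_def)
  have sets: "sets \<nu> = sets orthogonal_space" using assms(1) by (simp add: haar_orthogonal_def)
  have sp: "space \<nu> = {U. orthogonal_matrix U}"
    using sets_eq_imp_space_eq[OF sets] by (simp add: space_restrict_space)
  have "compact (f ` {U. orthogonal_matrix U})"
    by (intro compact_continuous_image compact_orthogonal continuous_on_subset[OF assms(2)]) auto
  then obtain B where "\<And>U. orthogonal_matrix U \<Longrightarrow> norm (f U) \<le> B"
    by (metis bounded_iff compact_imp_bounded image_eqI mem_Collect_eq)
  moreover have "f \<in> borel_measurable \<nu>"
    unfolding measurable_cong_sets[OF sets refl] by (rule borel_measurable_orthogonal_space) fact
  ultimately show ?thesis
    by (intro integrable_const_bound[of _ B]) (auto simp: sp)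
qed

text \<open>Change of variables along the map from \<open>U\<close> to \<open>A ** U\<close>, under
  which \<open>\<nu>\<close> is its own image.\<close>

lemma integral_haar_orthogonal_mult_left:
  fixes f :: "real ^ 'n ^ 'n \<Rightarrow> real"
  assumes "haar_orthogonal \<nu>" and "continuous_on UNIV f" and "orthogonal_matrix A"
  shows "(\<integral>U. f (A ** U) \<partial>\<nu>) = (\<integral>U. f U \<partial>\<nu>)"
proof -
  have sets: "sets \<nu> = sets orthogonal_space" using assms(1) by (simp add: haar_orthogonal_def)
  have inv: "distr \<nu> \<nu> (\<lambda>U. A ** U) = \<nu>" using assms(1,3) by (simp add: haar_orthogonal_def)
  have "continuous_on UNIV (\<lambda>U :: real ^ 'n ^ 'n. A ** U)"
    unfolding matrix_matrix_mult_def by (intro continuous_intros)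
  then have "(\<lambda>U. A ** U) \<in> measurable orthogonal_space orthogonal_space"
    by (intro measurable_restrict_space2 borel_measurable_orthogonal_space)
       (auto simp: space_restrict_space orthogonal_matrix_mul assms(3))
  then have "(\<lambda>U. A ** U) \<in> measurable \<nu> \<nu>"
    unfolding measurable_cong_sets[OF sets sets] .
  moreover have "f \<in> borel_measurable \<nu>"
    unfolding measurable_cong_sets[OF sets refl] by (rule borel_measurable_orthogonal_space) fact
  ultimately have "(\<integral>U. f U \<partial>distr \<nu> \<nu> (\<lambda>U. A ** U)) = (\<integral>U. f (A ** U) \<partial>\<nu>)"
    by (rule integral_distr)
  then show ?thesis
    by (simp add: inv)
qed

section \<open>The expected sum of squared diagonal entries\<close>

lemma haar_row_form_diagonal:
  fixes \<nu> :: "(real ^ 'n ^ 'n) measure" and d :: "real ^ 'n"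
  assumes haar: "haar_orthogonal \<nu>"
  shows "(real CARD('n) + 2) * (\<integral>U. (\<Sum>i\<in>UNIV. (row_form d U i i)\<^sup>2) \<partial>\<nu>) =
    (\<Sum>k\<in>UNIV. d $ k)\<^sup>2 + 2 * (\<Sum>k\<in>UNIV. (d $ k)\<^sup>2)"
proof -
  interpret prob_space \<nu> using haar by (simp add: haar_orthogonal_def)
  have sp: "space \<nu> = {U. orthogonal_matrix U}"
    using haar sets_eq_imp_space_eq[of \<nu> orthogonal_space]
    by (simp add: haar_orthogonal_def space_restrict_space)
  \<comment> \<open>For i \<noteq> j, \<open>?F i j\<close> is twice the amount by which the
    reflection lowers B_ii^2 + B_jj^2. Invariance of the measure then forces its integral to
    vanish.\<close>
  let ?F = "\<lambda>i j U. (row_form d U i i)\<^sup>2 + (row_form d U j j)\<^sup>2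
      - 2 * row_form d U i i * row_form d U j j - 4 * (row_form d U i j)\<^sup>2"
  let ?S = "\<lambda>U. \<Sum>i\<in>UNIV. (row_form d U i i)\<^sup>2"
  have int: "integrable \<nu> f" if "continuous_on UNIV f" for f :: "real ^ 'n ^ 'n \<Rightarrow> real"
    using haar that by (rule integrable_haar_orthogonal)
  have off: "(\<integral>U. ?F i j U \<partial>\<nu>) = 0" if "i \<noteq> j" for i j
  proof -
    let ?f = "\<lambda>U. (row_form d U i i)\<^sup>2 + (row_form d U j j)\<^sup>2"
    have f: "continuous_on UNIV ?f" and F: "continuous_on UNIV (?F i j)"
      by (intro continuous_intros)+
    have "(\<integral>U. ?f U \<partial>\<nu>) = (\<integral>U. ?f (mix_matrix i j ** U) \<partial>\<nu>)"
      by (rule integral_haar_orthogonal_mult_left[OF haar f orthogonal_mix_matrix[OF that], symmetric])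
    also have "\<dots> = (\<integral>U. ?f U - ?F i j U / 2 \<partial>\<nu>)"
      unfolding row_form_mix_matrix[OF that]
      by (intro Bochner_Integration.integral_cong refl) (simp add: power2_eq_square field_simps)
    also have "\<dots> = (\<integral>U. ?f U \<partial>\<nu>) - (\<integral>U. ?F i j U \<partial>\<nu>) / 2"
      using int[OF f] int[OF F] by (subst Bochner_Integration.integral_diff) auto
    finally show ?thesis by simp
  qed
  have S: "continuous_on UNIV ?S"
    by (intro continuous_intros)
  \<comment> \<open>Over all ordered pairs, each of the two squares contributes n times
    \<open>?S U\<close>. The products B_ii B_jj sum to the squared trace, and the B_ij^2 sum to the
    squared Frobenius norm.\<close>
  have sumF: "(\<Sum>i\<in>UNIV. \<Sum>j\<in>UNIV. ?F i j U) =
      2 * real CARD('n) * ?S U - 2 * (\<Sum>k\<in>UNIV. d $ k)\<^sup>2 - 4 * (\<Sum>k\<in>UNIV. (d $ k)\<^sup>2)"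
    if "orthogonal_matrix U" for U
  proof -
    have "(\<Sum>k\<in>UNIV. d $ k)\<^sup>2 = (\<Sum>i\<in>UNIV. \<Sum>j\<in>UNIV. row_form d U i i * row_form d U j j)"
      unfolding row_form_trace[OF that, symmetric] power2_eq_square sum_product ..
    then show ?thesis
      unfolding row_form_sum_squares[OF that, symmetric]
      by (simp add: sum.distrib sum_subtractf sum_distrib_left mult.assoc)
  qed
  have "(\<integral>U. (\<Sum>i\<in>UNIV. \<Sum>j\<in>UNIV. ?F i j U) \<partial>\<nu>) = (\<Sum>i\<in>UNIV. \<Sum>j\<in>UNIV. \<integral>U. ?F i j U \<partial>\<nu>)"
    by (subst Bochner_Integration.integral_sum; (intro int continuous_intros)?)+ (rule refl)
  \<comment> \<open>Only the pairs i = j survive. There the first three terms cancel and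
    \<open>?F i i\<close> is -4 B_ii^2.\<close>
  also have "\<dots> = (\<Sum>i\<in>UNIV. \<Sum>j\<in>UNIV. if i = j then \<integral>U. ?F i i U \<partial>\<nu> else 0)"
    by (intro sum.cong refl) (simp only: off split: if_splits, auto simp: off)
  also have "\<dots> = (\<Sum>i\<in>UNIV. \<integral>U. - 4 * (row_form d U i i)\<^sup>2 \<partial>\<nu>)"
    by (simp add: power2_eq_square algebra_simps)
  also have "\<dots> = - 4 * (\<integral>U. ?S U \<partial>\<nu>)"
    by (subst Bochner_Integration.integral_sum)
       (auto simp: sum_distrib_left sum_negf intro!: int continuous_intros)
  \<comment> \<open>The same integral is now evaluated through \<open>sumF\<close>. Equating both
    values gives 2n E - 2 (tr)^2 - 4 sum d_k^2 = -4 E, where E is the integral of \<open>?S\<close>;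
    the claim is half of this.\<close>
  also have "(\<integral>U. (\<Sum>i\<in>UNIV. \<Sum>j\<in>UNIV. ?F i j U) \<partial>\<nu>) =
      (\<integral>U. 2 * real CARD('n) * ?S U - (2 * (\<Sum>k\<in>UNIV. d $ k)\<^sup>2 + 4 * (\<Sum>k\<in>UNIV. (d $ k)\<^sup>2)) \<partial>\<nu>)"
    by (intro Bochner_Integration.integral_cong refl) (simp add: sp sumF)
  also have "\<dots> = 2 * real CARD('n) * (\<integral>U. ?S U \<partial>\<nu>)
      - (2 * (\<Sum>k\<in>UNIV. d $ k)\<^sup>2 + 4 * (\<Sum>k\<in>UNIV. (d $ k)\<^sup>2))"
    using int[OF S] by (subst Bochner_Integration.integral_diff) (auto simp: prob_space)
  finally show ?thesis
    by (simp add: algebra_simps)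
qed

text \<open>The sum over all ordered pairs counts each unordered pair twice and vanishes on the
  diagonal. Expanding the square there gives twice the right-hand side.\<close>

lemma sum_diff_squares:
  fixes d :: "real ^ ('n::{finite,linorder})"
  shows "(\<Sum>(i, j)\<in>{(i, j). i < j}. (d $ i - d $ j)\<^sup>2) =
    real CARD('n) * (\<Sum>k\<in>UNIV. (d $ k)\<^sup>2) - (\<Sum>k\<in>UNIV. d $ k)\<^sup>2"
proof -
  let ?f = "\<lambda>(i, j). (d $ i - d $ j)\<^sup>2"
  have swap: "sum ?f {(i, j). j < i} = sum ?f {(i, j). i < j}"
    by (rule sum.reindex_bij_witness[of _ prod.swap prod.swap]) (auto simp: power2_commute)
  have "(\<Sum>i\<in>UNIV. \<Sum>j\<in>UNIV. (d $ i - d $ j)\<^sup>2) = sum ?f UNIV"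
    by (simp add: sum.cartesian_product)
  also have "\<dots> = sum ?f ({(i, j). i < j} \<union> {(i, j). j < i})"
    by (rule sum.mono_neutral_right) (auto simp: not_less_iff_gr_or_eq)
  also have "\<dots> = sum ?f {(i, j). i < j} + sum ?f {(i, j). j < i}"
    by (rule sum.union_disjoint) auto
  finally have "2 * sum ?f {(i, j). i < j} = (\<Sum>i\<in>UNIV. \<Sum>j\<in>UNIV. (d $ i - d $ j)\<^sup>2)"
    by (simp add: swap)
  also have "\<dots> = 2 * (real CARD('n) * (\<Sum>k\<in>UNIV. (d $ k)\<^sup>2) - (\<Sum>k\<in>UNIV. d $ k)\<^sup>2)"
    by (simp add: power2_diff sum.distrib sum_subtractf power2_eq_square[of "sum _ _"] mult.assoc
        sum_distrib_left[symmetric] sum_distrib_right[symmetric])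
  finally show ?thesis by simp
qed

section \<open>Row norms and their variance in terms of a singular value decomposition\<close>

lemma transpose_diag_mat [simp]: "transpose (diag_mat d) = diag_mat d"
  by (auto simp: transpose_def diag_mat_def vec_eq_iff)

lemma matrix_mult_diag_mat: "(X ** diag_mat d) $ i $ k = X $ i $ k * d $ k"
proof -
  have "X $ i $ l * diag_mat d $ l $ k = (if l = k then X $ i $ k * d $ k else 0)" for l
    by (simp add: diag_mat_def)
  then show ?thesis
    by (simp add: matrix_matrix_mult_def)
qed

lemma diag_mat_mult: "diag_mat d ** diag_mat e = diag_mat (\<chi> k. d $ k * e $ k)"
  unfolding vec_eq_iff matrix_mult_diag_mat by (simp add: diag_mat_def)

text \<open>Right multiplication by \<open>W\<close> acts on each row as the isometry
  \<open>transpose W\<close>. This removes the factor V from all row norms.\<close>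

lemma norm_row_mult_orthogonal:
  fixes X :: "real ^ 'n ^ 'm" and W :: "real ^ 'n ^ 'n"
  assumes "orthogonal_matrix W"
  shows "norm (row i (X ** W)) = norm (row i X)"
proof -
  have "row i (X ** W) = transpose W *v row i X"
    by (simp add: row_def matrix_matrix_mult_def matrix_vector_mult_def transpose_def vec_eq_iff mult.commute)
  then show ?thesis
    using orthogonal_transformation_norm[of "(*v) (transpose W)"] assms
    by (simp add: orthogonal_transformation_matrix del: transpose_matrix_vector)
qed

lemma row_sqnorms_svd:
  fixes U V :: "real ^ 'n ^ 'n"
  assumes "orthogonal_matrix V"
  shows "row_sqnorms (U ** diag_mat d ** transpose V) $ i = row_form (\<chi> k. (d $ k)\<^sup>2) U i i"
proof -
  have "row_sqnorms (U ** diag_mat d ** transpose V) $ i = (norm (row i (U ** diag_mat d)))\<^sup>2"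
    using assms by (simp add: row_sqnorms_def norm_row_mult_orthogonal)
  then show ?thesis
    by (simp add: norm_vec_def L2_set_def sum_nonneg row_def matrix_mult_diag_mat row_form_def
        power_mult_distrib) (simp add: power2_eq_square mult_ac)
qed

lemma norm_sq_eq_sum_row_sqnorms: "(norm X)\<^sup>2 = (\<Sum>i\<in>UNIV. row_sqnorms X $ i)"
  by (simp add: norm_vec_def[of X] L2_set_def sum_nonneg row_sqnorms_def row_def)

text \<open>Variance is mean square minus squared mean. The mean is the trace divided by n and does
  not depend on \<open>U\<close>, so only the sum of squared diagonal entries remains
  random.\<close>

lemma row_sqnorm_var_svd:
  fixes U V :: "real ^ 'n ^ 'n" and d :: "real ^ 'n"
  assumes "orthogonal_matrix U" "orthogonal_matrix V"
  shows "row_sqnorm_var (U ** diag_mat d ** transpose V) =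
    (1 / real CARD('n)) * ((\<Sum>i\<in>UNIV. (row_form (\<chi> k. (d $ k)\<^sup>2) U i i)\<^sup>2)
       - (\<Sum>k\<in>UNIV. (d $ k)\<^sup>2)\<^sup>2 / real CARD('n))"
proof -
  let ?q = "\<lambda>i. row_form (\<chi> k. (d $ k)\<^sup>2) U i i"
  let ?t = "\<Sum>k\<in>UNIV. (d $ k)\<^sup>2"
  have tr: "(\<Sum>i\<in>UNIV. ?q i) = ?t"
    using row_form_trace[OF assms(1), of "\<chi> k. (d $ k)\<^sup>2"] by simp
  have "(\<Sum>i\<in>UNIV. (?q i - ?t / real CARD('n))\<^sup>2) =
      (\<Sum>i\<in>UNIV. (?q i)\<^sup>2) + real CARD('n) * (?t / real CARD('n))\<^sup>2 - 2 * (\<Sum>i\<in>UNIV. ?q i) * (?t / real CARD('n))"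
    by (simp add: power2_diff sum.distrib sum_subtractf sum_distrib_left sum_distrib_right mult.assoc
        del: times_divide_eq_right times_divide_eq_left)
  also have "\<dots> = (\<Sum>i\<in>UNIV. (?q i)\<^sup>2) - ?t\<^sup>2 / real CARD('n)"
    unfolding tr by (simp add: power2_eq_square field_simps)
  finally show ?thesis
    by (simp add: row_sqnorm_var_def norm_sq_eq_sum_row_sqnorms row_sqnorms_svd[OF assms(2)] tr)
qed

text \<open>The variance depends on the outcome only through \<open>U\<close>, so its expectation is
  an integral over the law of \<open>U\<close>. The diagonal \<open>d\<close> is kept general to
  serve the matrix both before and after the step; integrability is recorded so that the expectation
  of the difference can be split.\<close>

lemma expectation_row_sqnorm_var_svd:
  fixes U V :: "'w \<Rightarrow> real ^ ('n::{finite,linorder}) ^ ('n::{finite,linorder})" and d :: "real ^ ('n::{finite,linorder})"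
  assumes P: "prob_space P" and U: "haar_distributed P U"
    and V: "\<And>\<omega>. \<omega> \<in> space P \<Longrightarrow> orthogonal_matrix (V \<omega>)"
    and X: "\<And>\<omega>. \<omega> \<in> space P \<Longrightarrow> X \<omega> = U \<omega> ** diag_mat d ** transpose (V \<omega>)"
  shows "integrable P (\<lambda>\<omega>. row_sqnorm_var (X \<omega>))"
    and "prob_space.expectation P (\<lambda>\<omega>. row_sqnorm_var (X \<omega>)) =
      2 / ((real CARD('n))\<^sup>2 * (real CARD('n) + 2)) *
      (\<Sum>(i, j)\<in>{(i, j). i < j}. ((d $ i)\<^sup>2 - (d $ j)\<^sup>2)\<^sup>2)"
proof -
  interpret prob_space P by fact
  let ?n = "real CARD('n)"
  let ?t = "\<Sum>k\<in>UNIV. (d $ k)\<^sup>2"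
  let ?e = "\<chi> k. (d $ k)\<^sup>2"
  let ?S = "\<lambda>W. \<Sum>i\<in>UNIV. (row_form ?e W i i)\<^sup>2"
  have meas: "U \<in> measurable P orthogonal_space"
    and haar: "haar_orthogonal (distr P orthogonal_space U)"
    using U by (auto simp: haar_distributed_def)
  have orth: "orthogonal_matrix (U \<omega>)" if "\<omega> \<in> space P" for \<omega>
    using measurable_space[OF meas that] by (simp add: space_restrict_space)
  have cont: "continuous_on UNIV ?S"
    by (intro continuous_intros)
  note S = borel_measurable_orthogonal_space[OF cont]
  have int: "integrable P (\<lambda>\<omega>. ?S (U \<omega>))"
    using integrable_haar_orthogonal[OF haar cont] by (simp add: integrable_distr_eq[OF meas S])
  have var: "row_sqnorm_var (X \<omega>) = (1 / ?n) * (?S (U \<omega>) - ?t\<^sup>2 / ?n)" if "\<omega> \<in> space P" for \<omega>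
    using row_sqnorm_var_svd[OF orth[OF that] V[OF that]] X[OF that] by simp
  have "integrable P (\<lambda>\<omega>. (1 / ?n) * (?S (U \<omega>) - ?t\<^sup>2 / ?n))"
    using int by (intro integrable_mult_right Bochner_Integration.integrable_diff) auto
  then show "integrable P (\<lambda>\<omega>. row_sqnorm_var (X \<omega>))"
    by (subst Bochner_Integration.integrable_cong[OF refl]) (auto simp: var)
  have "expectation (\<lambda>\<omega>. row_sqnorm_var (X \<omega>)) = expectation (\<lambda>\<omega>. (1 / ?n) * (?S (U \<omega>) - ?t\<^sup>2 / ?n))"
    by (intro Bochner_Integration.integral_cong refl var)
  also have "\<dots> = (1 / ?n) * (expectation (\<lambda>\<omega>. ?S (U \<omega>)) - ?t\<^sup>2 / ?n)"
    using int by (subst integral_mult_right_zero, subst Bochner_Integration.integral_diff) (auto simp: prob_space)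
  also have "expectation (\<lambda>\<omega>. ?S (U \<omega>)) = (?t\<^sup>2 + 2 * (\<Sum>k\<in>UNIV. ((d $ k)\<^sup>2)\<^sup>2)) / (?n + 2)"
    using haar_row_form_diagonal[OF haar, of ?e]
    by (simp add: integral_distr[OF meas S] field_simps)
  also have "(1 / ?n) * ((?t\<^sup>2 + 2 * (\<Sum>k\<in>UNIV. ((d $ k)\<^sup>2)\<^sup>2)) / (?n + 2) - ?t\<^sup>2 / ?n) =
      2 / (?n\<^sup>2 * (?n + 2)) * (?n * (\<Sum>k\<in>UNIV. ((d $ k)\<^sup>2)\<^sup>2) - ?t\<^sup>2)"
  proof -
    \<comment> \<open>Here \<open>t\<close> stands for the squared sum \<open>?t\<^sup>2\<close>.
      Over the denominator n (n + 2) its terms combine to n t - (n + 2) t = -2 t, so a factor 2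
      splits off.\<close>
    have "(1 / n) * ((t + 2 * s) / (n + 2) - t / n) = 2 / (n\<^sup>2 * (n + 2)) * (n * s - t)"
      if "n > 0" for n s t :: real
      using that by (simp add: divide_simps power2_eq_square) algebra
    then show ?thesis by simp
  qed
  also have "?n * (\<Sum>k\<in>UNIV. ((d $ k)\<^sup>2)\<^sup>2) - ?t\<^sup>2 =
      (\<Sum>(i, j)\<in>{(i, j). i < j}. ((d $ i)\<^sup>2 - (d $ j)\<^sup>2)\<^sup>2)"
    using sum_diff_squares[of ?e] by simp
  finally show "expectation (\<lambda>\<omega>. row_sqnorm_var (X \<omega>)) =
      2 / (?n\<^sup>2 * (?n + 2)) * (\<Sum>(i, j)\<in>{(i, j). i < j}. ((d $ i)\<^sup>2 - (d $ j)\<^sup>2)\<^sup>2)" .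
qed

section \<open>The Newton-Schulz step acts on the singular values alone\<close>

lemma newton_schulz_svd:
  fixes U V :: "real ^ 'n ^ 'n"
  assumes U: "orthogonal_matrix U" and V: "orthogonal_matrix V"
  shows "newton_schulz a b c (U ** diag_mat d ** transpose V) =
    U ** diag_mat (\<chi> k. ns_phi a b c (d $ k)) ** transpose V"
proof -
  \<comment> \<open>The factor V cancels in M M^T, which becomes \<open>?Y\<close> of the squares.
    The matrices \<open>?Y e\<close> multiply by multiplying diagonals and act likewise on
    \<open>?X f\<close>, so the three terms are \<open>?X\<close> of the first, third and fifth
    powers of \<open>d\<close>.\<close>
  let ?X = "\<lambda>e. U ** diag_mat e ** transpose V" and ?Y = "\<lambda>e. U ** diag_mat e ** transpose U"
  have UU: "transpose U ** (U ** Z) = Z" and VV: "transpose V ** (V ** Z) = Z"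
    for Z :: "real ^ 'n ^ 'n"
    using U V by (simp_all add: matrix_mul_assoc orthogonal_matrix)
  have DD: "diag_mat e ** (diag_mat f ** Z) = diag_mat (\<chi> k. e $ k * f $ k) ** Z"
    for e f :: "real ^ 'n" and Z :: "real ^ 'n ^ 'n"
    by (simp add: matrix_mul_assoc diag_mat_mult)
  have XX: "?X d ** transpose (?X d) = ?Y (\<chi> k. d $ k * d $ k)"
    by (simp add: matrix_transpose_mul matrix_mul_assoc[symmetric] VV DD)
  have YX: "?Y e ** ?X f = ?X (\<chi> k. e $ k * f $ k)" and YY: "?Y e ** ?Y f = ?Y (\<chi> k. e $ k * f $ k)" for e f
    by (simp_all add: matrix_mul_assoc[symmetric] UU DD)
  \<comment> \<open>Each entry of \<open>?X e\<close> is linear in \<open>e\<close>, so the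
    combination of the three terms is \<open>?X\<close> of the combined diagonal.\<close>
  have entry: "?X e $ i $ j = (\<Sum>k\<in>UNIV. U $ i $ k * e $ k * V $ j $ k)" for e i j
    by (subst matrix_matrix_mult_def) (simp add: matrix_mult_diag_mat transpose_def)
  show ?thesis
    unfolding newton_schulz_def XX YY YX
    by (simp add: vec_eq_iff entry ns_phi_def sum_distrib_left sum.distrib[symmetric]
        algebra_simps numeral_eq_Suc)
qed

section \<open>Mean values of g and the expected change of the variance\<close>

lemma ns_g_mean_value:
  assumes "0 \<le> x" "x < y"
  obtains \<xi> where "x < \<xi>" "\<xi> < y" "ns_g a b c y - ns_g a b c x = (y - x) * deriv (ns_g a b c) \<xi>"
proof -
  have cont: "continuous_on {x..y} (ns_g a b c)"
    unfolding ns_g_def ns_phi_def by (intro continuous_intros)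
  \<comment> \<open>The square root in \<open>ns_g\<close> is not differentiable at 0, and
    \<open>x\<close> may be 0. Differentiability is therefore claimed only to the right of
    \<open>x\<close>; at the endpoints the mean value theorem asks just for continuity.\<close>
  have D: "(ns_g a b c has_real_derivative deriv (ns_g a b c) z) (at z)" if "x < z" for z
  proof -
    have "\<exists>D. (ns_g a b c has_real_derivative D) (at z)"
      unfolding ns_g_def ns_phi_def using that assms(1)
      by (intro exI) (rule derivative_eq_intros refl | simp)+
    then show ?thesis
      using DERIV_imp_deriv by blast
  qed
  obtain \<xi> where "x < \<xi>" "\<xi> < y"
    and "ns_g a b c y - ns_g a b c x = deriv (ns_g a b c) \<xi> * (y - x)"
    using mvt[OF assms(2) cont D[unfolded has_field_derivative_def]] by blast
  then show thesis
    by (intro that[of \<xi>]) (simp_all add: mult.commute)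
qed

theorem lemma2p1:
  fixes P :: "'w measure"
    and M U V :: "'w \<Rightarrow> real ^ ('n::{finite,linorder}) ^ ('n::{finite,linorder})"
    and \<sigma> :: "real ^ ('n::{finite,linorder})"
    and lam :: "'n::{finite,linorder} \<Rightarrow> real"
    and a b c :: real
  assumes "prob_space P"
    and "haar_distributed P U"
    and "V \<in> borel_measurable P"
    and "\<And>\<omega>. \<omega> \<in> space P \<Longrightarrow> orthogonal_matrix (V \<omega>)"
    and "\<And>k. 0 \<le> \<sigma> $ k \<and> \<sigma> $ k \<le> 1"
    and "\<And>\<omega>. \<omega> \<in> space P \<Longrightarrow> M \<omega> = U \<omega> ** diag_mat \<sigma> ** transpose (V \<omega>)"
    and "\<And>\<omega>. \<omega> \<in> space P \<Longrightarrow> (norm (M \<omega>))\<^sup>2 = 1"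
    and "\<And>k. lam k = (\<sigma> $ k)\<^sup>2"
  shows "\<exists>\<xi> :: 'n \<Rightarrow> 'n \<Rightarrow> real.
    (\<forall>i j. i < j \<longrightarrow> lam i \<noteq> lam j \<longrightarrow>
       \<xi> i j \<in> {min (lam i) (lam j)<..<max (lam i) (lam j)}) \<and>
    prob_space.expectation P
      (\<lambda>\<omega>. row_sqnorm_var (newton_schulz a b c (M \<omega>)) - row_sqnorm_var (M \<omega>)) =
    2 / ((real CARD('n))\<^sup>2 * (real CARD('n) + 2)) *
    (\<Sum>(i, j) \<in> {(i, j). i < j}.
       (lam i - lam j)\<^sup>2 * ((deriv (ns_g a b c) (\<xi> i j))\<^sup>2 - 1))"
proof -
  interpret prob_space P by fact
  let ?g = "ns_g a b c"
  let ?K = "2 / ((real CARD('n))\<^sup>2 * (real CARD('n) + 2))"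
  let ?Q = "\<lambda>\<omega>. newton_schulz a b c (M \<omega>)"
  have lam_nonneg: "0 \<le> lam k" and sqrt_lam: "sqrt (lam k) = \<sigma> $ k" for k
    using assms(5,8) by auto
  \<comment> \<open>For \<open>lam i = lam j\<close> the open interval is empty, hence the guard;
    both sides of the equation are then 0 for any \<open>x\<close>. Otherwise the mean value theorem
    is applied in increasing order, and squaring removes the sign.\<close>
  have "\<exists>x. (lam i \<noteq> lam j \<longrightarrow> x \<in> {min (lam i) (lam j)<..<max (lam i) (lam j)}) \<and>
      (?g (lam i) - ?g (lam j))\<^sup>2 = (lam i - lam j)\<^sup>2 * (deriv ?g x)\<^sup>2" for i j
  proof (rule linorder_cases[of "lam i" "lam j"])
    assume less: "lam i < lam j"
    obtain x where "lam i < x" "x < lam j" "?g (lam j) - ?g (lam i) = (lam j - lam i) * deriv ?g x"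
      using ns_g_mean_value[OF lam_nonneg less] .
    then show ?thesis
      by (intro exI[of _ x]) (simp add: power2_commute[of "?g (lam i)"] power2_commute[of "lam i"] power_mult_distrib)
  next
    assume less: "lam j < lam i"
    obtain x where "lam j < x" "x < lam i" "?g (lam i) - ?g (lam j) = (lam i - lam j) * deriv ?g x"
      using ns_g_mean_value[OF lam_nonneg less] .
    then show ?thesis
      by (intro exI[of _ x]) (simp add: power_mult_distrib)
  qed simp
  then obtain \<xi> where \<xi>: "\<And>i j. lam i \<noteq> lam j \<Longrightarrow> \<xi> i j \<in> {min (lam i) (lam j)<..<max (lam i) (lam j)}"
    and g: "\<And>i j. (?g (lam i) - ?g (lam j))\<^sup>2 = (lam i - lam j)\<^sup>2 * (deriv ?g (\<xi> i j))\<^sup>2"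
    by metis
  have orth: "orthogonal_matrix (U \<omega>)" if "\<omega> \<in> space P" for \<omega>
    using assms(2) measurable_space[OF _ that, of U orthogonal_space]
    by (simp add: haar_distributed_def space_restrict_space)
  have Q: "?Q \<omega> = U \<omega> ** diag_mat (\<chi> k. ns_phi a b c (\<sigma> $ k)) ** transpose (V \<omega>)"
    if "\<omega> \<in> space P" for \<omega>
    using newton_schulz_svd[OF orth[OF that] assms(4)[OF that]] assms(6)[OF that] by simp
  \<comment> \<open>One formula is used with two diagonals, \<phi>(\<sigma>) and \<sigma>. Since
    \<sigma>_k is the nonnegative root of \<open>lam k\<close>, the squared diagonal entries are
    \<open>?g (lam k)\<close> and \<open>lam k\<close>.\<close>
  note EQ = expectation_row_sqnorm_var_svd[OF assms(1,2,4) Q]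
  note EM = expectation_row_sqnorm_var_svd[OF assms(1,2,4,6)]
  have "expectation (\<lambda>\<omega>. row_sqnorm_var (?Q \<omega>) - row_sqnorm_var (M \<omega>)) =
      expectation (\<lambda>\<omega>. row_sqnorm_var (?Q \<omega>)) - expectation (\<lambda>\<omega>. row_sqnorm_var (M \<omega>))"
    by (rule Bochner_Integration.integral_diff[OF EQ(1) EM(1)])
  also have "\<dots> = ?K * ((\<Sum>(i, j)\<in>{(i, j). i < j}. (?g (lam i) - ?g (lam j))\<^sup>2)
      - (\<Sum>(i, j)\<in>{(i, j). i < j}. (lam i - lam j)\<^sup>2))"
    by (simp add: EQ(2) EM(2) ns_g_def sqrt_lam assms(8)[symmetric] right_diff_distrib diff_divide_distrib)
  also have "\<dots> = ?K * (\<Sum>(i, j)\<in>{(i, j). i < j}. (lam i - lam j)\<^sup>2 * ((deriv ?g (\<xi> i j))\<^sup>2 - 1))"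
    by (simp add: g sum_subtractf[symmetric] case_prod_beta right_diff_distrib)
  finally show ?thesis
    using \<xi> by blast
qed

end
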